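(* Assume the following. (A1) There exists $\mathcal{K}_{\mathcal{H}}>0$ such that every $h\in\mathcal{H}$ is a bounded $\mathcal{K}_{\mathcal{H}}$-Lipschitz map $\mathcal{X}\to\mathcal{Y}$, and $\sup_{h\in\mathcal{H}}\|h\|_\infty<\infty$. (A2) There exists $\mathcal{K}_\ell>0$ such that the loss $\ell:\mathcal{Y}\times\mathcal{Y}\to[0,\infty)$ is bounded and $\mathcal{K}_\ell$-Lipschitz, and $M:=\sup_{h\in\mathcal{H}}\sup_{(x,y)\in\mathcal{Z}}|\ell(h(x),y)|<\infty$. (A3) $\psi$ is one of the four functions ($\theta$, $\eta$, $\kappa$ or $\lambda$ type) listed in the context, the process $\{Z_t=(X_t,Y_t),\,t\in\mathbb{Z}\}$ is stationary ergodic and $(\Lambda_1(\mathcal{Z}),\psi,\epsilon)$-weakly dependent, and there exist $L_1,L_2,\mu\ge 0$ with $$\sum_{j\ge 0}(j+1)^k\epsilon_j\le L_1L_2^k(k!)^\mu\quad\text{for all integers }k\ge 0 .$$ Suppose moreover that the covering number $\mathcal{N}(\mathcal{H},r)$ is finite for every $r>0$. Then the empirical risk minimization algorithm is consistent within $\mathcal{H}$: $R(\widehat{h}_n)-R(h_{\mathcal{H}})\to 0$ in probability as $n\to\infty$.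
   Context: Setting. $\mathcal{X}$ and $\mathcal{Y}$ are subsets of separable Banach spaces with norms $\|\cdot\|_{\mathcal{X}},\|\cdot\|_{\mathcal{Y}}$, and $\mathcal{Z}=\mathcal{X}\times\mathcal{Y}$. The process $\{Z_t=(X_t,Y_t),\,t\in\mathbb{Z}\}$ is stationary and ergodic with values in $\mathcal{Z}$; $Z_1,\dots,Z_n$ is the observed sample. $\mathcal{H}$ is a set of functions (predictors) $h:\mathcal{X}\to\mathcal{Y}$, and $\ell:\mathcal{Y}\times\mathcal{Y}\to[0,\infty)$ is a loss function. The risk and empirical risk are $$R(h)=\mathbb{E}[\ell(h(X_0),Y_0)],\qquad \widehat{R}_n(h)=\frac1n\sum_{i=1}^n\ell(h(X_i),Y_i).$$ The target $h_{\mathcal{H}}\in\operatorname{argmin}_{h\in\mathcal{H}}R(h)$ and the empirical target $\widehat{h}_n\in\operatorname{argmin}_{h\in\mathcal{H}}\widehat{R}_n(h)$ are assumed to exist; $R(\widehat{h}_n)$ denotes the function $R$ evaluated at the (random) element $\widehat{h}_n$. Finite products of normed spaces carry the sum norm $\|(x_1,\dots,x_k)\|=\|x_1\|+\dots+\|x_k\|$. For a function $h$, $\|h\|_\infty=\sup_x\|h(x)\|$ and $\mathrm{Lip}(h)=\sup_{x_1\ne x_2}\|h(x_1)-h(x_2)\|/\|x_1-x_2\|$. For $r>0$, $\mathcal{N}(\mathcal{H},r)$ is the $r$-covering number: the least $m\ge1$ such that there are $h_1,\dots,h_m\in\mathcal{H}$ with every $h\in\mathcal{H}$ satisfying $\|h-h_i\|_\infty\le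 r$ for some $i$. Weak dependence. For $E$ a separable Banach space (or the set $\mathcal{Z}$ with the sum norm), $\Lambda_1(E)$ is the set of functions $g:E^u\to\mathbb{R}$, for some $u\in\mathbb{N}$, with $\|g\|_\infty<\infty$ and $\mathrm{Lip}(g)\le1$. An $E$-valued process $(Z_t)_{t\in\mathbb{Z}}$ is $(\Lambda_1(E),\psi,\epsilon)$-weakly dependent if $\psi:[0,\infty)^2\times\mathbb{N}^2\to[0,\infty)$ is a function and $\epsilon=(\epsilon(r))_{r\in\mathbb{N}}$ is a sequence decreasing to zero at infinity (written $\epsilon_r=\epsilon(r)$) such that for all $g_1,g_2\in\Lambda_1(E)$, $g_1:E^u\to\mathbb{R}$, $g_2:E^v\to\mathbb{R}$, and all $s_1\le\dots\le s_u\le s_u+r\le t_1\le\dots\le t_v$, $$|\mathrm{Cov}(g_1(Z_{s_1},\dots,Z_{s_u}),g_2(Z_{t_1},\dots,Z_{t_v}))|\le\psi(\mathrm{Lip}(g_1),\mathrm{Lip}(g_2),u,v)\,\epsilon(r).$$ The four choices of $\psi(\mathrm{Lip}(g_1),\mathrm{Lip}(g_2),u,v)$ are: $v\,\mathrm{Lip}(g_2)$ ($\theta$-weak dependence); $u\,\mathrm{Lip}(g_1)+v\,\mathrm{Lip}(g_2)$ ($\eta$); $uv\,\mathrm{Lip}(g_1)\mathrm{Lip}(g_2)$ ($\kappa$); $u\,\mathrm{Lip}(g_1)+v\,\mathrm{Lip}(g_2)+uv\,\mathrm{Lip}(g_1)\mathrm{Lip}(g_2)$ ($\lambda$). *)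

theory Defs
  imports "HOL-Probability.Probability"
begin

section \<open>Norms and Lipschitz constants\<close>

text \<open>Isabelle's norm on a product type is the Euclidean one; the sum norm is introduced
  through its distance. Suprema are taken in \<^typ>\<open>ennreal\<close>, so that they may be infinite and
  the supremum over the empty set is 0.\<close>

definition sum_dist :: "'a::real_normed_vector \<times> 'b::real_normed_vector \<Rightarrow> 'a \<times> 'b \<Rightarrow> real" where
  "sum_dist p q = norm (fst p - fst q) + norm (snd p - snd q)"

definition tuple_dist :: "('e \<Rightarrow> 'e \<Rightarrow> real) \<Rightarrow> nat \<Rightarrow> (nat \<Rightarrow> 'e) \<Rightarrow> (nat \<Rightarrow> 'e) \<Rightarrow> real" where
  "tuple_dist d u x y = (\<Sum>i = 1..u. d (x i) (y i))"

definition sup_norm :: "'p set \<Rightarrow> ('p \<Rightarrow> 'c::real_normed_vector) \<Rightarrow> ennreal" where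
  "sup_norm D f = (SUP x\<in>D. ennreal (norm (f x)))"

definition Lip :: "('p \<Rightarrow> 'p \<Rightarrow> real) \<Rightarrow> 'p set \<Rightarrow> ('p \<Rightarrow> 'c::real_normed_vector) \<Rightarrow> ennreal" where
  "Lip d D f =
     (SUP (x, y) \<in> {(x, y). x \<in> D \<and> y \<in> D \<and> x \<noteq> y}. ennreal (norm (f x - f y) / d x y))"


section \<open>Stationary ergodic processes\<close>

definition path_law :: "'w measure \<Rightarrow> 'e measure \<Rightarrow> (int \<Rightarrow> 'w \<Rightarrow> 'e) \<Rightarrow> (int \<Rightarrow> 'e) measure" where
  "path_law M N Z = distr M (\<Pi>\<^sub>M t\<in>UNIV. N) (\<lambda>\<omega> t. Z t \<omega>)"

definition stationary_process :: "'w measure \<Rightarrow> 'e measure \<Rightarrow> (int \<Rightarrow> 'w \<Rightarrow> 'e) \<Rightarrow> bool" where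
  "stationary_process M N Z \<longleftrightarrow>
     (\<forall>t. Z t \<in> measurable M N) \<and> (\<forall>k. path_law M N (\<lambda>t. Z (t + k)) = path_law M N Z)"

definition ergodic_process :: "'w measure \<Rightarrow> 'e measure \<Rightarrow> (int \<Rightarrow> 'w \<Rightarrow> 'e) \<Rightarrow> bool" where
  "ergodic_process M N Z \<longleftrightarrow>
     (\<forall>A \<in> sets (path_law M N Z).
        (\<lambda>x t. x (t + 1)) -` A \<inter> space (path_law M N Z) = A \<longrightarrow>
        measure (path_law M N Z) A \<in> {0, 1})"


section \<open>Weak dependence\<close>

definition Lambda1 :: "('e \<Rightarrow> 'e \<Rightarrow> real) \<Rightarrow> 'e set \<Rightarrow> nat \<Rightarrow> ((nat \<Rightarrow> 'e) \<Rightarrow> real) set" where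
  "Lambda1 d E u =
     {g. sup_norm ({1..u} \<rightarrow>\<^sub>E E) g < \<infinity> \<and> Lip (tuple_dist d u) ({1..u} \<rightarrow>\<^sub>E E) g \<le> 1}"

definition cov :: "'w measure \<Rightarrow> ('w \<Rightarrow> real) \<Rightarrow> ('w \<Rightarrow> real) \<Rightarrow> real" where
  "cov M U V =
     (\<integral>\<omega>. U \<omega> * V \<omega> \<partial>M) - (\<integral>\<omega>. U \<omega> \<partial>M) * (\<integral>\<omega>. V \<omega> \<partial>M)"

definition weakly_dependent ::
  "'w measure \<Rightarrow> ('e \<Rightarrow> 'e \<Rightarrow> real) \<Rightarrow> 'e set \<Rightarrow> (real \<Rightarrow> real \<Rightarrow> nat \<Rightarrow> nat \<Rightarrow> real) \<Rightarrow>
   (nat \<Rightarrow> real) \<Rightarrow> (int \<Rightarrow> 'w \<Rightarrow> 'e) \<Rightarrow> bool" where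
  "weakly_dependent M d E \<psi> \<epsilon> Z \<longleftrightarrow>
     (\<forall>a\<ge>0. \<forall>b\<ge>0. \<forall>u v. 0 \<le> \<psi> a b u v) \<and> decseq \<epsilon> \<and> \<epsilon> \<longlonglongrightarrow> 0 \<and>
     (\<forall>u\<ge>1. \<forall>v\<ge>1. \<forall>g1 \<in> Lambda1 d E u. \<forall>g2 \<in> Lambda1 d E v. \<forall>r. \<forall>s t :: nat \<Rightarrow> int.
        mono_on {1..u} s \<and> s u + int r \<le> t 1 \<and> mono_on {1..v} t \<longrightarrow>
        \<bar>cov M (\<lambda>\<omega>. g1 (\<lambda>i\<in>{1..u}. Z (s i) \<omega>)) (\<lambda>\<omega>. g2 (\<lambda>i\<in>{1..v}. Z (t i) \<omega>))\<bar>
          \<le> \<psi> (enn2real (Lip (tuple_dist d u) ({1..u} \<rightarrow>\<^sub>E E) g1))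
               (enn2real (Lip (tuple_dist d v) ({1..v} \<rightarrow>\<^sub>E E) g2)) u v * \<epsilon> r)"

definition psi_theta :: "real \<Rightarrow> real \<Rightarrow> nat \<Rightarrow> nat \<Rightarrow> real" where
  "psi_theta a b u v = real v * b"

definition psi_eta :: "real \<Rightarrow> real \<Rightarrow> nat \<Rightarrow> nat \<Rightarrow> real" where
  "psi_eta a b u v = real u * a + real v * b"

definition psi_kappa :: "real \<Rightarrow> real \<Rightarrow> nat \<Rightarrow> nat \<Rightarrow> real" where
  "psi_kappa a b u v = real u * real v * a * b"

definition psi_lambda :: "real \<Rightarrow> real \<Rightarrow> nat \<Rightarrow> nat \<Rightarrow> real" where
  "psi_lambda a b u v = real u * a + real v * b + real u * real v * a * b"


section \<open>Empirical risk minimization\<close>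

text \<open>Predictors are functions on the whole type, but only their values on the input set
  \<open>X\<close> are ever used.\<close>

definition covering_number :: "'a set \<Rightarrow> ('a \<Rightarrow> 'b::real_normed_vector) set \<Rightarrow> real \<Rightarrow> enat" where
  "covering_number X H r =
     Inf {enat m | m. 1 \<le> m \<and> (\<exists>c. (\<forall>i\<in>{1..m}. c i \<in> H) \<and>
       (\<forall>h\<in>H. \<exists>i\<in>{1..m}. sup_norm X (\<lambda>x. h x - c i x) \<le> ennreal r))}"

definition risk ::
  "'w measure \<Rightarrow> (int \<Rightarrow> 'w \<Rightarrow> 'a \<times> 'b) \<Rightarrow> ('b \<times> 'b \<Rightarrow> real) \<Rightarrow> ('a \<Rightarrow> 'b) \<Rightarrow> real" where
  "risk M Z l h = (\<integral>\<omega>. l (h (fst (Z 0 \<omega>)), snd (Z 0 \<omega>)) \<partial>M)"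

definition emp_risk ::
  "(int \<Rightarrow> 'w \<Rightarrow> 'a \<times> 'b) \<Rightarrow> ('b \<times> 'b \<Rightarrow> real) \<Rightarrow> nat \<Rightarrow> 'w \<Rightarrow> ('a \<Rightarrow> 'b) \<Rightarrow> real" where
  "emp_risk Z l n \<omega> h =
     1 / real n * (\<Sum>i = 1..n. l (h (fst (Z (int i) \<omega>)), snd (Z (int i) \<omega>)))"


section \<open>Convergence in probability\<close>

text \<open>The outer measure is used because the risk of an empirical minimizer, chosen separately
  for every sample point, need not be measurable. For random variables this is the usual notion.\<close>

definition tendsto_in_prob :: "'w measure \<Rightarrow> (nat \<Rightarrow> 'w \<Rightarrow> real) \<Rightarrow> real \<Rightarrow> bool" where
  "tendsto_in_prob M W c \<longleftrightarrow>
     (\<forall>\<delta>>0. (\<lambda>n. outer_measure_of M {\<omega> \<in> space M. \<delta> < \<bar>W n \<omega> - c\<bar>}) \<longlonglongrightarrow> 0)"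

lemma tendsto_in_prob_random_variable:
  assumes "prob_space M" "\<And>n. W n \<in> borel_measurable M"
  shows "tendsto_in_prob M W c \<longleftrightarrow>
    (\<forall>\<delta>>0. (\<lambda>n. measure M {\<omega> \<in> space M. \<delta> < \<bar>W n \<omega> - c\<bar>}) \<longlonglongrightarrow> 0)"
proof -
  interpret prob_space M by fact
  have "outer_measure_of M {\<omega> \<in> space M. \<delta> < \<bar>W n \<omega> - c\<bar>}
      = ennreal (measure M {\<omega> \<in> space M. \<delta> < \<bar>W n \<omega> - c\<bar>})" for \<delta> n
    using assms(2)[of n] by (subst outer_measure_of_eq) (auto simp: emeasure_eq_measure)
  then show ?thesis
    unfolding tendsto_in_prob_def
    by (simp add: tendsto_ennreal_iff[of _ _ 0, simplified])
qed

end

theory Submission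
  imports Defs
begin

text \<open>Empirical minimization can only go wrong if the empirical risk is somewhere far from the
  risk: the excess risk of an empirical minimizer is at most twice the largest deviation
  \<open>\<bar>emp_risk h - risk h\<bar>\<close> over \<open>h \<in> H\<close> (lemma \<open>excess_risk_le\<close>). Both risks
  inherit from the Lipschitz loss a Lipschitz dependence on \<open>h\<close> in the uniform norm, so a
  finite net of \<open>H\<close> at a scale proportional to the tolerance \<open>\<delta>\<close> reduces the uniform
  deviation to that of finitely many fixed predictors. No rate is claimed, and a union bound over
  a net independent of \<open>n\<close> therefore needs only a weak law of large numbers for each
  predictor, instead of an exponential inequality.

  For a fixed \<open>h\<close> the loss \<open>l (h x, y)\<close> is a bounded Lipschitz function of
  \<open>(x, y)\<close>. Weak dependence with one past and one future time bounds its autocovariances at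
  lag \<open>r\<close> by a constant times \<open>\<epsilon> r\<close>, uniformly over the four choices of
  \<open>\<psi>\<close> (lemma \<open>weakly_dependent_cov_le\<close>). Since \<open>\<epsilon>\<close> is summable (the decay
  condition with \<open>k = 0\<close>), the variance of the empirical mean is of order \<open>1 / n\<close>, and
  Chebyshev's inequality gives the weak law (lemma \<open>weak_law_summable_covariance\<close>).\<close>

section \<open>A weak law of large numbers under summable covariances\<close>

lemma sum_lag_le:
  fixes c :: "nat \<Rightarrow> real"
  assumes "summable c" "\<And>r. 0 \<le> c r"
  shows "(\<Sum>j=1..n. c (if i \<le> j then j - i else i - j)) \<le> 2 * suminf c"
proof -
  have *: "(\<Sum>j\<in>A. c (f j)) \<le> suminf c" if "inj_on f A" "finite A" for A :: "nat set" and f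
    using sum_le_suminf[OF assms(1), of "f ` A"] assms(2) that by (simp add: sum.reindex)
  have "(\<Sum>j=1..n. c (if i \<le> j then j - i else i - j))
      = (\<Sum>j\<in>{1..n} \<inter> {j. i \<le> j}. c (j - i)) + (\<Sum>j\<in>{1..n} \<inter> - {j. i \<le> j}. c (i - j))"
    by (subst sum.If_cases[symmetric]) (auto intro!: sum.cong)
  also have "\<dots> \<le> suminf c + suminf c"
    by (intro add_mono *) (auto simp: inj_on_def)
  finally show ?thesis by simp
qed

text \<open>A pair of indices has covariance at most \<open>c\<close> of their distance, and each index sees
  each distance at most twice; hence the variance of a sum of \<open>n\<close> variables is at most
  \<open>2 * n * suminf c\<close>, and Chebyshev's inequality applies.\<close>

lemma weak_law_summable_covariance:
  fixes U :: "nat \<Rightarrow> 'w \<Rightarrow> real" and c :: "nat \<Rightarrow> real"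
  assumes "prob_space M"
    and meas: "\<And>i. U i \<in> borel_measurable M"
    and bdd: "\<And>i \<omega>. \<omega> \<in> space M \<Longrightarrow> \<bar>U i \<omega>\<bar> \<le> B"
    and mean: "\<And>i. (\<integral>\<omega>. U i \<omega> \<partial>M) = m"
    and cov: "\<And>i r. \<bar>cov M (U i) (U (i + r))\<bar> \<le> c r"
    and c: "summable c" "\<And>r. 0 \<le> c r"
    and \<delta>: "\<delta> > 0"
  shows "(\<lambda>n. measure M {\<omega> \<in> space M. \<delta> \<le> \<bar>1 / real n * (\<Sum>i=1..n. U i \<omega>) - m\<bar>}) \<longlonglongrightarrow> 0"
proof -
  interpret prob_space M by fact
  note [measurable] = meas
  have int: "integrable M (U i)" for i
    by (rule integrable_const_bound[of _ B]) (auto intro: bdd)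
  have int2: "integrable M (\<lambda>\<omega>. U i \<omega> * U j \<omega>)" for i j
    by (rule integrable_const_bound[of _ "B * B"])
       (auto simp: abs_mult intro!: mult_mono' bdd)
  define V where "V i \<omega> = U i \<omega> - m" for i \<omega>
  have V_expand: "V i \<omega> * V j \<omega> = U i \<omega> * U j \<omega> - m * U j \<omega> - m * U i \<omega> + m * m" for i j \<omega>
    by (simp add: V_def algebra_simps)
  have intV: "integrable M (\<lambda>\<omega>. V i \<omega> * V j \<omega>)" for i j
    unfolding V_expand using int int2 by simp
  have EV: "(\<integral>\<omega>. V i \<omega> * V j \<omega> \<partial>M) = cov M (U i) (U j)" for i j
    unfolding V_expand cov_def using int int2 mean by (simp add: prob_space)
  have cov_le: "cov M (U i) (U j) \<le> c (if i \<le> j then j - i else i - j)" for i j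
  proof (cases "i \<le> j")
    case True
    then show ?thesis using cov[of i "j - i"] by simp
  next
    case False
    moreover have "cov M (U i) (U j) = cov M (U j) (U i)"
      by (simp add: cov_def mult.commute)
    ultimately show ?thesis using cov[of j "i - j"] by simp
  qed
  have sq: "(\<Sum>i=1..n. V i \<omega>)\<^sup>2 = (\<Sum>i=1..n. \<Sum>j=1..n. V i \<omega> * V j \<omega>)" for n \<omega>
    by (simp add: power2_eq_square sum_product)
  have int_sq: "integrable M (\<lambda>\<omega>. (\<Sum>i=1..n. V i \<omega>)\<^sup>2)" for n
    unfolding sq using intV by simp
  have second_moment: "(\<integral>\<omega>. (\<Sum>i=1..n. V i \<omega>)\<^sup>2 \<partial>M) \<le> 2 * real n * suminf c" for n
  proof -
    have "(\<integral>\<omega>. (\<Sum>i=1..n. V i \<omega>)\<^sup>2 \<partial>M) = (\<Sum>i=1..n. \<Sum>j=1..n. cov M (U i) (U j))"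
      unfolding sq using intV by (simp add: EV)
    also have "\<dots> \<le> (\<Sum>i=1..n. \<Sum>j=1..n. c (if i \<le> j then j - i else i - j))"
      by (intro sum_mono cov_le)
    also have "\<dots> \<le> (\<Sum>i=1..n. 2 * suminf c)"
      by (intro sum_mono sum_lag_le c)
    finally show ?thesis by simp
  qed
  have bound: "measure M {\<omega> \<in> space M. \<delta> \<le> \<bar>1 / real n * (\<Sum>i=1..n. U i \<omega>) - m\<bar>}
      \<le> 2 * suminf c / \<delta>\<^sup>2 / real n" if n: "n > 0" for n
  proof -
    have "1 / real n * (\<Sum>i=1..n. U i \<omega>) - m = (\<Sum>i=1..n. V i \<omega>) / real n" for \<omega>
      using n by (simp add: V_def sum_subtractf field_simps)
    then have "\<delta> \<le> \<bar>1 / real n * (\<Sum>i=1..n. U i \<omega>) - m\<bar>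
        \<longleftrightarrow> (\<delta> * real n)\<^sup>2 \<le> (\<Sum>i=1..n. V i \<omega>)\<^sup>2" for \<omega>
      using n \<delta> by (simp add: abs_le_square_iff[symmetric] pos_le_divide_eq)
    then have "measure M {\<omega> \<in> space M. \<delta> \<le> \<bar>1 / real n * (\<Sum>i=1..n. U i \<omega>) - m\<bar>}
        = measure M {\<omega> \<in> space M. (\<delta> * real n)\<^sup>2 \<le> (\<Sum>i=1..n. V i \<omega>)\<^sup>2}"
      by simp
    also have "\<dots> \<le> (\<integral>\<omega>. (\<Sum>i=1..n. V i \<omega>)\<^sup>2 \<partial>M) / (\<delta> * real n)\<^sup>2"
      using n \<delta> by (intro integral_Markov_inequality_measure[where A = "{}"] int_sq) auto
    also have "\<dots> \<le> 2 * real n * suminf c / (\<delta> * real n)\<^sup>2"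
      by (intro divide_right_mono second_moment) simp
    also have "\<dots> = 2 * suminf c / \<delta>\<^sup>2 / real n"
      using n by (simp add: power2_eq_square)
    finally show ?thesis .
  qed
  show ?thesis
  proof (rule tendsto_sandwich[where f = "\<lambda>_. 0"])
    show "(\<lambda>n. 2 * suminf c / \<delta>\<^sup>2 / real n) \<longlonglongrightarrow> 0"
      by (rule lim_const_over_n)
    show "\<forall>\<^sub>F n in sequentially. measure M {\<omega> \<in> space M. \<delta> \<le> \<bar>1 / real n * (\<Sum>i=1..n. U i \<omega>) - m\<bar>}
        \<le> 2 * suminf c / \<delta>\<^sup>2 / real n"
      using eventually_gt_at_top[of "0::nat"] by eventually_elim (rule bound)
  qed simp_all
qed

section \<open>Stationarity and weak dependence for observables of a single time\<close>

lemma stationary_process_distr: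
  assumes "stationary_process M N Z"
  shows "distr M N (Z k) = distr M N (Z 0)"
proof -
  have Z [measurable]: "\<And>t. Z t \<in> measurable M N"
    and eq: "path_law M N (\<lambda>t. Z (t + k)) = path_law M N Z"
    using assms unfolding stationary_process_def by auto
  have "distr (path_law M N W) N (\<lambda>x. x 0) = distr M N (W 0)"
    if [measurable]: "\<And>t. W t \<in> measurable M N" for W :: "int \<Rightarrow> _"
    unfolding path_law_def
    by (subst distr_distr) (auto simp: comp_def PiE_UNIV_domain
        intro!: measurable_PiM_single' measurable_space[OF that])
  from this[of Z] this[of "\<lambda>t. Z (t + k)"] eq show ?thesis by simp
qed

lemma LipD:
  assumes "Lip d D f \<le> ennreal K" "K \<ge> 0" "x \<in> D" "y \<in> D" "x \<noteq> y" "d x y > 0"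
  shows "norm (f x - f y) \<le> K * d x y"
proof -
  have "ennreal (norm (f x - f y) / d x y) \<le> Lip d D f"
    unfolding Lip_def using assms by (intro SUP_upper2[of "(x, y)"]) auto
  also have "\<dots> \<le> ennreal K" by fact
  finally show ?thesis using assms by (simp add: pos_divide_le_eq)
qed

lemma sum_dist_pos: "p \<noteq> q \<Longrightarrow> sum_dist p q > 0"
  unfolding sum_dist_def
  by (metis add_nonneg_pos add_pos_nonneg norm_ge_zero prod_eq_iff right_minus_eq zero_less_norm_iff)

lemma enn2real_Lip_le_one:
  assumes "Lip d D f \<le> 1"
  shows "0 \<le> enn2real (Lip d D f)" "enn2real (Lip d D f) \<le> 1"
  using enn2real_mono[OF assms] by auto

text \<open>Dividing by its Lipschitz constant turns \<open>f\<close> into an admissible test function of one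
  variable, and for Lipschitz constants at most 1 and \<open>u = v = 1\<close> the largest of the four
  \<open>\<psi>\<close> is at most 3.\<close>

lemma weakly_dependent_cov_le:
  fixes f :: "'a::real_normed_vector \<times> 'b::real_normed_vector \<Rightarrow> real"
  assumes wd: "weakly_dependent M sum_dist E \<psi> \<epsilon> Z"
    and psi: "\<psi> \<in> {psi_theta, psi_eta, psi_kappa, psi_lambda}"
    and K: "K > 0"
    and lip: "\<And>p q. p \<in> E \<Longrightarrow> q \<in> E \<Longrightarrow> \<bar>f p - f q\<bar> \<le> K * sum_dist p q"
    and bdd: "\<And>p. p \<in> E \<Longrightarrow> \<bar>f p\<bar> \<le> B"
  shows "\<bar>cov M (\<lambda>\<omega>. f (Z s \<omega>)) (\<lambda>\<omega>. f (Z (s + int r) \<omega>))\<bar> \<le> 3 * K\<^sup>2 * \<epsilon> r"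
proof -
  have eps: "0 \<le> \<epsilon> r"
    using wd decseq_ge[of \<epsilon> 0 r] by (simp add: weakly_dependent_def)
  define g where "g x = f (x 1) / K" for x :: "nat \<Rightarrow> 'a \<times> 'b"
  define L where "L = Lip (tuple_dist sum_dist 1) ({1..1} \<rightarrow>\<^sub>E E) g"
  have dist: "sum_dist p q \<ge> 0" for p q :: "'a \<times> 'b"
    by (simp add: sum_dist_def)
  have "ennreal (norm (g x)) \<le> ennreal (B / K)" if "x \<in> {1..1} \<rightarrow>\<^sub>E E" for x
    using bdd[of "x 1"] PiE_mem[OF that, of 1] K
    by (intro ennreal_leI) (simp add: g_def divide_right_mono)
  then have "sup_norm ({1..1} \<rightarrow>\<^sub>E E) g \<le> ennreal (B / K)"
    unfolding sup_norm_def by (intro SUP_least)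
  then have sup_g: "sup_norm ({1..1} \<rightarrow>\<^sub>E E) g < \<infinity>"
    using ennreal_less_top le_less_trans unfolding infinity_ennreal_def by blast
  have L: "L \<le> 1"
    unfolding L_def Lip_def
  proof (intro SUP_least, clarify)
    fix x y :: "nat \<Rightarrow> 'a \<times> 'b"
    assume "x \<in> {1..1} \<rightarrow>\<^sub>E E" "y \<in> {1..1} \<rightarrow>\<^sub>E E"
    then have "\<bar>f (x 1) - f (y 1)\<bar> \<le> K * sum_dist (x 1) (y 1)"
      by (intro lip) auto
    moreover have "norm (g x - g y) = \<bar>f (x 1) - f (y 1)\<bar> / K"
      using K by (simp add: g_def flip: diff_divide_distrib)
    ultimately have "norm (g x - g y) \<le> sum_dist (x 1) (y 1)"
      using K by (simp add: pos_divide_le_eq mult.commute)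
    then have "norm (g x - g y) / tuple_dist sum_dist 1 x y \<le> 1"
      using dist[of "x 1" "y 1"] by (auto simp: tuple_dist_def divide_le_eq_1)
    then show "ennreal (norm (g x - g y) / tuple_dist sum_dist 1 x y) \<le> 1"
      by (simp add: ennreal_le_1)
  qed
  then have g: "g \<in> Lambda1 sum_dist E 1"
    using sup_g by (simp add: Lambda1_def L_def)
  have "\<bar>cov M (\<lambda>\<omega>. g (\<lambda>i\<in>{1..1}. Z s \<omega>)) (\<lambda>\<omega>. g (\<lambda>i\<in>{1..1}. Z (s + int r) \<omega>))\<bar>
      \<le> \<psi> (enn2real L) (enn2real L) 1 1 * \<epsilon> r"
    using wd[unfolded weakly_dependent_def, THEN conjunct2, THEN conjunct2, THEN conjunct2,
        rule_format, of 1 1 g g "\<lambda>_. s" r "\<lambda>_. s + int r"] g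
    by (simp add: L_def mono_on_def)
  also have "\<dots> \<le> 3 * \<epsilon> r"
  proof (rule mult_right_mono[OF _ eps])
    have a: "0 \<le> enn2real L" "enn2real L \<le> 1"
      using L enn2real_Lip_le_one unfolding L_def by auto
    then have "enn2real L * enn2real L \<le> 1" by (simp add: mult_le_one)
    then show "\<psi> (enn2real L) (enn2real L) 1 1 \<le> 3"
      using psi a
      by (auto simp: psi_theta_def psi_eta_def psi_kappa_def psi_lambda_def)
  qed
  finally have "\<bar>cov M (\<lambda>\<omega>. f (Z s \<omega>) / K) (\<lambda>\<omega>. f (Z (s + int r) \<omega>) / K)\<bar> \<le> 3 * \<epsilon> r"
    by (simp add: g_def)
  moreover have "cov M (\<lambda>\<omega>. f (Z s \<omega>) / K) (\<lambda>\<omega>. f (Z (s + int r) \<omega>) / K)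
      = cov M (\<lambda>\<omega>. f (Z s \<omega>)) (\<lambda>\<omega>. f (Z (s + int r) \<omega>)) / K\<^sup>2"
    by (simp add: cov_def power2_eq_square diff_divide_distrib)
  ultimately show ?thesis
    using K by (simp add: pos_divide_le_eq mult_ac)
qed

lemma sum_dist_lipschitz_continuous:
  fixes f :: "'a::real_normed_vector \<times> 'b::real_normed_vector \<Rightarrow> real"
  assumes "\<And>p q. p \<in> E \<Longrightarrow> q \<in> E \<Longrightarrow> \<bar>f p - f q\<bar> \<le> K * sum_dist p q" "K > 0"
  shows "continuous_on E f"
proof -
  have "(2 * K)-lipschitz_on E f"
  proof (rule lipschitz_onI)
    fix p q assume pq: "p \<in> E" "q \<in> E"
    have "norm (fst p - fst q) \<le> dist p q" "norm (snd p - snd q) \<le> dist p q"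
      using dist_fst_le[of p q] dist_snd_le[of p q] by (simp_all add: dist_norm)
    then have "sum_dist p q \<le> 2 * dist p q" by (simp add: sum_dist_def)
    then have "K * sum_dist p q \<le> K * (2 * dist p q)"
      using assms(2) by (intro mult_left_mono) auto
    with assms(1)[OF pq] show "dist (f p) (f q) \<le> 2 * K * dist p q"
      by (simp add: dist_real_def)
  qed (use assms(2) in simp)
  then show ?thesis by (rule lipschitz_on_continuous_on)
qed

lemma weak_law_weakly_dependent:
  fixes f :: "'a::{banach, second_countable_topology} \<times> 'b::{banach, second_countable_topology} \<Rightarrow> real"
  assumes "prob_space M"
    and st: "stationary_process M (restrict_space borel E) Z"
    and wd: "weakly_dependent M sum_dist E \<psi> \<epsilon> Z"
    and psi: "\<psi> \<in> {psi_theta, psi_eta, psi_kappa, psi_lambda}"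
    and sm: "summable \<epsilon>"
    and K: "K > 0"
    and lip: "\<And>p q. p \<in> E \<Longrightarrow> q \<in> E \<Longrightarrow> \<bar>f p - f q\<bar> \<le> K * sum_dist p q"
    and bdd: "\<And>p. p \<in> E \<Longrightarrow> \<bar>f p\<bar> \<le> B"
    and \<delta>: "\<delta> > 0"
  shows "(\<lambda>n. measure M {\<omega> \<in> space M.
      \<delta> \<le> \<bar>1 / real n * (\<Sum>i=1..n. f (Z (int i) \<omega>)) - (\<integral>\<omega>. f (Z 0 \<omega>) \<partial>M)\<bar>}) \<longlonglongrightarrow> 0"
proof -
  have f [measurable]: "f \<in> borel_measurable (restrict_space borel E)"
    by (rule borel_measurable_continuous_on_restrict sum_dist_lipschitz_continuous[OF lip K])+
  have Z [measurable]: "Z t \<in> measurable M (restrict_space borel E)" for t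
    using st by (simp add: stationary_process_def)
  have ZE: "Z t \<omega> \<in> E" if "\<omega> \<in> space M" for t \<omega>
    using measurable_space[OF Z that] by (simp add: space_restrict_space)
  have mean: "(\<integral>\<omega>. f (Z t \<omega>) \<partial>M) = (\<integral>\<omega>. f (Z 0 \<omega>) \<partial>M)" for t
    using stationary_process_distr[OF st, of t]
    by (metis integral_distr[OF Z f])
  have eps: "0 \<le> \<epsilon> r" for r
    using wd decseq_ge[of \<epsilon> 0 r] by (simp add: weakly_dependent_def)
  show ?thesis
  proof (rule weak_law_summable_covariance[OF assms(1) _ _ _ _ _ _ \<delta>, where c = "\<lambda>r. 3 * K\<^sup>2 * \<epsilon> r" and B = B])
    show "\<bar>cov M (\<lambda>\<omega>. f (Z (int i) \<omega>)) (\<lambda>\<omega>. f (Z (int (i + r)) \<omega>))\<bar> \<le> 3 * K\<^sup>2 * \<epsilon> r" for i r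
      using weakly_dependent_cov_le[OF wd psi K lip bdd, of "int i" r] by simp
    show "\<bar>f (Z (int i) \<omega>)\<bar> \<le> B" if "\<omega> \<in> space M" for i \<omega>
      by (rule bdd[OF ZE[OF that]])
    show "summable (\<lambda>r. 3 * K\<^sup>2 * \<epsilon> r)"
      using sm by (rule summable_mult)
  qed (use mean eps in simp_all)
qed

section \<open>From finitely many predictors to the empirical minimizer\<close>

text \<open>An empirical minimizer beats every competitor empirically, so both steps from empirical
  risk to risk, at the minimizer and at the competitor, cost one deviation each.\<close>

lemma excess_risk_le:
  fixes R Rn :: "'h \<Rightarrow> real"
  assumes "is_arg_min Rn (\<lambda>h. h \<in> H) h'" "h0 \<in> H" "\<And>h. h \<in> H \<Longrightarrow> \<bar>Rn h - R h\<bar> \<le> D"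
  shows "R h' - R h0 \<le> 2 * D"
proof -
  have "h' \<in> H" "Rn h' \<le> Rn h0"
    using assms(1,2) by (auto simp: is_arg_min_linorder)
  then show ?thesis
    using assms(3)[of h'] assms(3)[OF assms(2)] by linarith
qed

lemma covering_number_finiteD:
  assumes "covering_number X H r < \<infinity>"
  obtains C where "finite C" "C \<subseteq> H"
    "\<And>h. h \<in> H \<Longrightarrow> \<exists>c\<in>C. sup_norm X (\<lambda>x. h x - c x) \<le> ennreal r"
proof -
  obtain m :: nat and c where "\<forall>i\<in>{1..m}. c i \<in> H"
      "\<forall>h\<in>H. \<exists>i\<in>{1..m}. sup_norm X (\<lambda>x. h x - c i x) \<le> ennreal r"
    using assms unfolding covering_number_def Inf_less_iff by auto
  then show ?thesis
    by (intro that[of "c ` {1..m}"]) auto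
qed

lemma sup_normD:
  assumes "sup_norm D f \<le> ennreal r" "0 \<le> r" "x \<in> D"
  shows "norm (f x) \<le> r"
proof -
  have "ennreal (norm (f x)) \<le> sup_norm D f"
    unfolding sup_norm_def using assms(3) by (intro SUP_upper)
  also note assms(1)
  finally show ?thesis using assms(2) by simp
qed

lemma emp_risk_diff_le:
  assumes "\<And>i. \<bar>l (h (fst (Z (int i) \<omega>)), snd (Z (int i) \<omega>))
      - l (h' (fst (Z (int i) \<omega>)), snd (Z (int i) \<omega>))\<bar> \<le> e" "n \<ge> 1"
  shows "\<bar>emp_risk Z l n \<omega> h - emp_risk Z l n \<omega> h'\<bar> \<le> e"
proof -
  let ?d = "\<lambda>i. l (h (fst (Z (int i) \<omega>)), snd (Z (int i) \<omega>))
      - l (h' (fst (Z (int i) \<omega>)), snd (Z (int i) \<omega>))"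
  have "\<bar>emp_risk Z l n \<omega> h - emp_risk Z l n \<omega> h'\<bar> = 1 / real n * \<bar>\<Sum>i=1..n. ?d i\<bar>"
    by (simp add: emp_risk_def sum_subtractf flip: diff_divide_distrib)
  also have "\<dots> \<le> 1 / real n * (\<Sum>i=1..n. e)"
    by (intro mult_left_mono order_trans[OF sum_abs] sum_mono assms(1)) simp
  finally show ?thesis using assms(2) by simp
qed

theorem mainTheorem3:
  fixes M :: "'w measure"
    and X :: "'a::{banach, second_countable_topology} set"
    and Y :: "'b::{banach, second_countable_topology} set"
    and Z :: "int \<Rightarrow> 'w \<Rightarrow> 'a \<times> 'b"
    and H :: "('a \<Rightarrow> 'b) set"
    and l :: "'b \<times> 'b \<Rightarrow> real"
    and \<psi> :: "real \<Rightarrow> real \<Rightarrow> nat \<Rightarrow> nat \<Rightarrow> real"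
    and \<epsilon> :: "nat \<Rightarrow> real"
    and h_target :: "'a \<Rightarrow> 'b"
    and h_hat :: "nat \<Rightarrow> 'w \<Rightarrow> 'a \<Rightarrow> 'b"
  assumes prob: "prob_space M"
    and target: "is_arg_min (risk M Z l) (\<lambda>h. h \<in> H) h_target"
    and emp_target:
      "\<And>n \<omega>. n \<ge> 1 \<Longrightarrow> \<omega> \<in> space M \<Longrightarrow> is_arg_min (emp_risk Z l n \<omega>) (\<lambda>h. h \<in> H) (h_hat n \<omega>)"
    and A1: "\<exists>K>0. \<forall>h\<in>H. h \<in> X \<rightarrow> Y \<and> sup_norm X h < \<infinity> \<and> K-lipschitz_on X h"
      "(SUP h\<in>H. sup_norm X h) < \<infinity>"
    and loss_nonneg: "\<And>p. p \<in> Y \<times> Y \<Longrightarrow> 0 \<le> l p"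
    and A2: "\<exists>K>0. sup_norm (Y \<times> Y) l < \<infinity> \<and> Lip sum_dist (Y \<times> Y) l \<le> ennreal K"
      "(SUP h\<in>H. SUP (x, y) \<in> X \<times> Y. ennreal \<bar>l (h x, y)\<bar>) < \<infinity>"
    and A3_psi: "\<psi> \<in> {psi_theta, psi_eta, psi_kappa, psi_lambda}"
    and A3_process: "stationary_process M (restrict_space borel (X \<times> Y)) Z"
      "ergodic_process M (restrict_space borel (X \<times> Y)) Z"
      "weakly_dependent M sum_dist (X \<times> Y) \<psi> \<epsilon> Z"
    and A3_decay: "\<exists>L1\<ge>0. \<exists>L2\<ge>0. \<exists>\<mu>\<ge>0. \<forall>k::nat.
      summable (\<lambda>j. (real j + 1) ^ k * \<epsilon> j) \<and>
      (\<Sum>j. (real j + 1) ^ k * \<epsilon> j) \<le> L1 * L2 ^ k * fact k powr \<mu>"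
    and covering: "\<And>r. r > 0 \<Longrightarrow> covering_number X H r < \<infinity>"
  shows "tendsto_in_prob M (\<lambda>n \<omega>. risk M Z l (h_hat n \<omega>) - risk M Z l h_target) 0"
proof -
  interpret prob_space M by (rule prob)
  let ?E = "X \<times> Y"
  let ?R = "risk M Z l"
  obtain KH where KH: "KH > 0" "\<And>h. h \<in> H \<Longrightarrow> h \<in> X \<rightarrow> Y" "\<And>h. h \<in> H \<Longrightarrow> KH-lipschitz_on X h"
    using A1(1) by blast
  obtain K where K: "K > 0" and sup_l: "sup_norm (Y \<times> Y) l < \<infinity>"
    and Lip_l: "Lip sum_dist (Y \<times> Y) l \<le> ennreal K"
    using A2(1) by blast
  obtain B where B: "B \<ge> 0" "\<And>p. p \<in> Y \<times> Y \<Longrightarrow> \<bar>l p\<bar> \<le> B"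
  proof (rule that)
    have eq: "sup_norm (Y \<times> Y) l = ennreal (enn2real (sup_norm (Y \<times> Y) l))"
      using sup_l by simp
    show "\<bar>l p\<bar> \<le> enn2real (sup_norm (Y \<times> Y) l)" if "p \<in> Y \<times> Y" for p
      using sup_normD[OF eq_refl[OF eq] _ that] by simp
  qed simp
  have l_lip: "\<bar>l p - l q\<bar> \<le> K * sum_dist p q" if "p \<in> Y \<times> Y" "q \<in> Y \<times> Y" for p q
  proof (cases "p = q")
    case False
    then show ?thesis
      using LipD[OF Lip_l _ that False sum_dist_pos[OF False]] K by simp
  qed (simp add: sum_dist_def)
  define F where "F h p = l (h (fst p), snd p)" for h and p :: "'a \<times> 'b"
  define K' where "K' = K * (KH + 1)"
  have K': "K' > 0" using K KH(1) by (simp add: K'_def)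
  have F_bdd: "\<bar>F h p\<bar> \<le> B" if "h \<in> H" "p \<in> ?E" for h p
    using KH(2)[OF that(1)] that(2) by (auto simp: F_def intro!: B(2))
  have F_lip: "\<bar>F h p - F h q\<bar> \<le> K' * sum_dist p q" if h: "h \<in> H" and pq: "p \<in> ?E" "q \<in> ?E" for h p q
  proof -
    have "\<bar>F h p - F h q\<bar> \<le> K * (norm (h (fst p) - h (fst q)) + norm (snd p - snd q))"
      using l_lip[of "(h (fst p), snd p)" "(h (fst q), snd q)"] funcset_mem[OF KH(2)[OF h]] pq
      by (simp add: F_def sum_dist_def mem_Times_iff)
    also have "norm (h (fst p) - h (fst q)) \<le> KH * norm (fst p - fst q)"
      using lipschitz_onD[OF KH(3)[OF h], of "fst p" "fst q"] pq by (auto simp: dist_norm)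
    also have "KH * norm (fst p - fst q) + norm (snd p - snd q) \<le> (KH + 1) * sum_dist p q"
      using KH(1) by (simp add: sum_dist_def algebra_simps)
    finally show ?thesis
      using K by (simp add: K'_def mult.assoc)
  qed
  have F_net: "\<bar>F h p - F h' p\<bar> \<le> K * r"
    if "h \<in> H" "h' \<in> H" "p \<in> ?E" "r \<ge> 0" "sup_norm X (\<lambda>x. h x - h' x) \<le> ennreal r" for h h' p r
  proof -
    have "\<bar>F h p - F h' p\<bar> \<le> K * norm (h (fst p) - h' (fst p))"
      using l_lip[of "(h (fst p), snd p)" "(h' (fst p), snd p)"] 
        funcset_mem[OF KH(2)[OF that(1)]] funcset_mem[OF KH(2)[OF that(2)]] that(3)
      by (simp add: F_def sum_dist_def mem_Times_iff)
    also have "\<dots> \<le> K * r"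
      using sup_normD[OF that(5,4), of "fst p"] that(3) K by (intro mult_left_mono) auto
    finally show ?thesis .
  qed
  have sm: "summable \<epsilon>"
  proof -
    obtain L1 L2 \<mu> where "\<forall>k::nat. summable (\<lambda>j. (real j + 1) ^ k * \<epsilon> j) \<and>
      (\<Sum>j. (real j + 1) ^ k * \<epsilon> j) \<le> L1 * L2 ^ k * fact k powr \<mu>"
      using A3_decay by blast
    then have "summable (\<lambda>j. (real j + 1) ^ 0 * \<epsilon> j)" by blast
    then show ?thesis by simp
  qed
  have Z [measurable]: "Z t \<in> measurable M (restrict_space borel ?E)" for t
    using A3_process(1) by (simp add: stationary_process_def)
  have ZE: "Z t \<omega> \<in> ?E" if "\<omega> \<in> space M" for t \<omega>
    using measurable_space[OF Z that] by (simp add: space_restrict_space)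
  have risk_F: "?R h = (\<integral>\<omega>. F h (Z 0 \<omega>) \<partial>M)" for h
    by (simp add: risk_def F_def)
  have emp_F: "emp_risk Z l n \<omega> h = 1 / real n * (\<Sum>i=1..n. F h (Z (int i) \<omega>))" for n \<omega> h
    by (simp add: emp_risk_def F_def)
  have law: "(\<lambda>n. measure M {\<omega> \<in> space M. d \<le> \<bar>emp_risk Z l n \<omega> h - ?R h\<bar>}) \<longlonglongrightarrow> 0"
    if "h \<in> H" "d > 0" for h d
    unfolding emp_F risk_F using F_lip[OF that(1)] F_bdd[OF that(1)] that(2)
    by (rule weak_law_weakly_dependent[OF prob A3_process(1,3) A3_psi sm K'])
  have F_meas: "F h \<in> borel_measurable (restrict_space borel ?E)" if "h \<in> H" for h
    by (rule borel_measurable_continuous_on_restrict sum_dist_lipschitz_continuous[OF F_lip[OF that] K'])+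
  have F_int: "integrable M (\<lambda>\<omega>. F h (Z 0 \<omega>))" if h: "h \<in> H" for h
    using measurable_compose[OF Z F_meas[OF h]] F_bdd[OF h ZE]
    by (intro integrable_const_bound[of _ B]) auto

  show ?thesis
    unfolding tendsto_in_prob_def
  proof (intro allI impI)
    fix \<delta> :: real assume \<delta>: "\<delta> > 0"
    \<comment> \<open>Passing to the net costs \<open>K * r\<close> in the risk and again in the empirical risk, at
      both the minimizer and the target: this radius makes the total \<open>\<delta> / 2\<close>.\<close>
    define r where "r = \<delta> / (8 * K)"
    have r: "r > 0" and Kr: "K * r = \<delta> / 8" using \<delta> K by (auto simp: r_def)
    obtain C where C: "finite C" "C \<subseteq> H"
      "\<And>h. h \<in> H \<Longrightarrow> \<exists>c\<in>C. sup_norm X (\<lambda>x. h x - c x) \<le> ennreal r"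
      by (rule covering_number_finiteD[OF covering[OF r]]) blast
    define bad where "bad n c = {\<omega> \<in> space M. \<delta> / 4 \<le> \<bar>emp_risk Z l n \<omega> c - ?R c\<bar>}" for n c
    have bad_sets: "bad n c \<in> sets M" if "c \<in> C" for n c
    proof -
      have [measurable]: "(\<lambda>\<omega>. F c (Z t \<omega>)) \<in> borel_measurable M" for t
        using measurable_compose[OF Z F_meas] C(2) that by blast
      show ?thesis unfolding bad_def emp_F by measurable
    qed
    have lim: "(\<lambda>n. \<Sum>c\<in>C. measure M (bad n c)) \<longlonglongrightarrow> 0"
    proof (rule tendsto_null_sum)
      fix c assume "c \<in> C"
      then have c: "c \<in> H" using C(2) by blast
      show "(\<lambda>n. measure M (bad n c)) \<longlonglongrightarrow> 0"
        unfolding bad_def using \<delta> by (intro law c) simp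
    qed
    \<comment> \<open>The event on the left need not be measurable; the finite union on the right is, so it
      controls the outer measure.\<close>
    have incl: "{\<omega> \<in> space M. \<delta> < \<bar>?R (h_hat n \<omega>) - ?R h_target - 0\<bar>} \<subseteq> (\<Union>c\<in>C. bad n c)"
      if n: "n \<ge> 1" for n
    proof
      fix \<omega> assume \<omega>: "\<omega> \<in> {\<omega> \<in> space M. \<delta> < \<bar>?R (h_hat n \<omega>) - ?R h_target - 0\<bar>}"
      then have sp: "\<omega> \<in> space M" by simp
      note arg = emp_target[OF n sp]
      have tgt: "h_target \<in> H" "?R h_target \<le> ?R (h_hat n \<omega>)"
        using target arg by (auto simp: is_arg_min_linorder)
      show "\<omega> \<in> (\<Union>c\<in>C. bad n c)"
      proof (rule ccontr)
        assume "\<omega> \<notin> (\<Union>c\<in>C. bad n c)"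
        then have good: "\<bar>emp_risk Z l n \<omega> c - ?R c\<bar> \<le> \<delta> / 4" if "c \<in> C" for c
          using that sp by (auto simp: bad_def not_le less_imp_le)
        have "\<bar>emp_risk Z l n \<omega> h - ?R h\<bar> \<le> \<delta> / 2" if h: "h \<in> H" for h
        proof -
          obtain c where c: "c \<in> C" "sup_norm X (\<lambda>x. h x - c x) \<le> ennreal r"
            using C(3)[OF h] by blast
          have cH: "c \<in> H" using c(1) C(2) by blast
          have diff: "\<bar>F h p - F c p\<bar> \<le> \<delta> / 8" if "p \<in> ?E" for p
            using F_net[OF h cH that _ c(2)] r Kr by simp
          have "\<bar>emp_risk Z l n \<omega> h - emp_risk Z l n \<omega> c\<bar> \<le> \<delta> / 8"
            using diff[OF ZE[OF sp]] n by (intro emp_risk_diff_le) (auto simp: F_def)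
          moreover have "\<bar>?R h - ?R c\<bar> \<le> \<delta> / 8"
          proof -
            have "?R h - ?R c = (\<integral>\<omega>. F h (Z 0 \<omega>) - F c (Z 0 \<omega>) \<partial>M)"
              by (simp add: risk_F F_int h cH)
            also have "\<bar>\<dots>\<bar> \<le> (\<integral>\<omega>. \<bar>F h (Z 0 \<omega>) - F c (Z 0 \<omega>)\<bar> \<partial>M)"
              by (rule integral_abs_bound)
            also have "\<dots> \<le> (\<integral>\<omega>. \<delta> / 8 \<partial>M)"
              using diff ZE F_int[OF h] F_int[OF cH] by (intro integral_mono) auto
            finally show ?thesis by (simp add: prob_space)
          qed
          ultimately show ?thesis using good[OF c(1)] by linarith
        qed
        then have "?R (h_hat n \<omega>) - ?R h_target \<le> 2 * (\<delta> / 2)"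
          by (rule excess_risk_le[OF arg tgt(1)])
        then show False using \<omega> tgt(2) by auto
      qed
    qed
    let ?P = "\<lambda>n. outer_measure_of M {\<omega> \<in> space M. \<delta> < \<bar>?R (h_hat n \<omega>) - ?R h_target - 0\<bar>}"
    have le: "?P n \<le> ennreal (\<Sum>c\<in>C. measure M (bad n c))" if n: "n \<ge> 1" for n
    proof -
      have "?P n \<le> outer_measure_of M (\<Union>c\<in>C. bad n c)"
        by (rule outer_measure_of_mono[OF incl[OF n]])
      also have "\<dots> = emeasure M (\<Union>c\<in>C. bad n c)"
        using C(1) bad_sets by (intro outer_measure_of_eq) auto
      also have "\<dots> \<le> ennreal (\<Sum>c\<in>C. measure M (bad n c))"
        unfolding emeasure_eq_measure using C(1) bad_sets
        by (intro ennreal_leI finite_measure_subadditive_finite) auto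
      finally show ?thesis .
    qed
    show "?P \<longlonglongrightarrow> 0"
    proof (rule tendsto_sandwich[where f = "\<lambda>_. 0"])
      show "(\<lambda>n. ennreal (\<Sum>c\<in>C. measure M (bad n c))) \<longlonglongrightarrow> 0"
        using tendsto_ennrealI[OF lim] by simp
      show "\<forall>\<^sub>F n in sequentially. ?P n \<le> ennreal (\<Sum>c\<in>C. measure M (bad n c))"
        using eventually_ge_at_top[of "1::nat"] by eventually_elim (rule le)
    qed simp_all
  qed
qed

end
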